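(* Let $k\geq 3$, let $q_k(t)=(1+t)^k$, and let $r(t)\in\mathbb{Z}[t]$ be a polynomial of degree at most $k-2$ with constant term $1$ that is not divisible by $1+t$. Then $p(t)=q_k(t)+t\,r(t)$ is not the $\gamma$-polynomial of any flag homology sphere (of any dimension).
   Context: A simplicial complex is a finite family of subsets (faces) of a finite vertex set, closed under subsets, with every vertex a face; pure of dimension $d-1$ if all maximal faces have $d$ elements. Link: $\mathrm{lk}_\Delta(f)=\{g\in\Delta:g\cap f=\emptyset,\ g\cup f\in\Delta\}$. A $(d-1)$-dimensional homology sphere over a field $\mathbb{K}$ is a pure $(d-1)$-dimensional complex such that for every face $f$ (including $\emptyset$), $\tilde H_i(\mathrm{lk}_\Delta(f);\mathbb{K})$ is $0$ for $i<d-1-|f|$ and $\mathbb{K}$ for $i=d-1-|f|$. Flag: every minimal non-face has two elements. With $f_i$ the number of faces of cardinality $i$ ($f_0=1$) and $h(z)=\sum_{i=0}^d f_i(z-1)^{d-i}$, for a $(d-1)$-dimensional homology sphere write uniquely $h(z)=\sum_{i=0}^{\lfloor d/2\rfloor}\gamma_iz^i(1+z)^{d-2i}$; the $\gamma$-polynomial is $\gamma^\Delta(t)=\sum_i\gamma_it^i$. *)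

theory Defs
  imports "HOL-Computational_Algebra.Polynomial" "HOL-Library.Function_Algebras"
begin

text \<open>
  A complex is given by its set of faces; its vertex set is \<open>\<Union>\<Delta>\<close>, so that every vertex
  is a face by closure under subsets. The empty set is required to be a face (\<open>f\<^sub>0 = 1\<close>), which
  excludes the void complex but not \<open>{{}}\<close>, the sphere of dimension \<open>-1\<close>.
\<close>

definition simplicial_complex :: "'v set set \<Rightarrow> bool" where
  "simplicial_complex \<Delta> \<longleftrightarrow>
     finite (\<Union>\<Delta>) \<and> {} \<in> \<Delta> \<and> (\<forall>f\<in>\<Delta>. \<forall>g. g \<subseteq> f \<longrightarrow> g \<in> \<Delta>)"

definition link :: "'v set set \<Rightarrow> 'v set \<Rightarrow> 'v set set" where
  "link \<Delta> f = {g \<in> \<Delta>. g \<inter> f = {} \<and> g \<union> f \<in> \<Delta>}"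

definition maximal_face :: "'v set set \<Rightarrow> 'v set \<Rightarrow> bool" where
  "maximal_face \<Delta> f \<longleftrightarrow> f \<in> \<Delta> \<and> (\<forall>g\<in>\<Delta>. f \<subseteq> g \<longrightarrow> g = f)"

text \<open>The parameter \<open>d\<close> below is one more than the dimension.\<close>

definition pure_complex :: "nat \<Rightarrow> 'v set set \<Rightarrow> bool" where
  "pure_complex d \<Delta> \<longleftrightarrow> simplicial_complex \<Delta> \<and> (\<forall>f. maximal_face \<Delta> f \<longrightarrow> card f = d)"

definition minimal_nonface :: "'v set set \<Rightarrow> 'v set \<Rightarrow> bool" where
  "minimal_nonface \<Delta> f \<longleftrightarrow> f \<subseteq> \<Union>\<Delta> \<and> f \<notin> \<Delta> \<and> (\<forall>g. g \<subset> f \<longrightarrow> g \<in> \<Delta>)"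

definition flag_complex :: "'v set set \<Rightarrow> bool" where
  "flag_complex \<Delta> \<longleftrightarrow> simplicial_complex \<Delta> \<and> (\<forall>f. minimal_nonface \<Delta> f \<longrightarrow> card f = 2)"

text \<open>
  Reduced simplicial homology with coefficients in the field \<open>'k\<close>. A chain is the family of its
  coefficients, each face being oriented by the order of the vertices; the empty face spans
  the chains of degree \<open>-1\<close>. The linear order only serves to fix signs.
\<close>

definition simplicial_chains :: "'v set set \<Rightarrow> int \<Rightarrow> ('v set \<Rightarrow> 'k::field) set" where
  "simplicial_chains \<Delta> i = {c. \<forall>f. c f \<noteq> 0 \<longrightarrow> f \<in> \<Delta> \<and> int (card f) = i + 1}"

text \<open>
  For \<open>v\<^sub>0 < \<dots> < v\<^sub>n\<close> the boundary of \<open>[v\<^sub>0, \<dots>, v\<^sub>n]\<close> is the sum over \<open>j\<close> of \<open>(- 1) ^ j\<close> times the face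
  omitting \<open>v\<^sub>j\<close>. So the coefficient at \<open>g\<close> of the boundary of \<open>c\<close> collects the faces \<open>insert v g\<close>,
  in which the position \<open>j\<close> of \<open>v\<close> is the number of elements of \<open>g\<close> below \<open>v\<close>.
\<close>

definition boundary ::
  "'v::linorder set set \<Rightarrow> ('v set \<Rightarrow> 'k::field) \<Rightarrow> 'v set \<Rightarrow> 'k" where
  "boundary \<Delta> c = (\<lambda>g. \<Sum>v\<in>\<Union>\<Delta> - g. (- 1) ^ card {w \<in> g. w < v} * c (insert v g))"

definition cycles :: "'v::linorder set set \<Rightarrow> int \<Rightarrow> ('v set \<Rightarrow> 'k::field) set" where
  "cycles \<Delta> i = {c \<in> simplicial_chains \<Delta> i. boundary \<Delta> c = 0}"

definition boundaries :: "'v::linorder set set \<Rightarrow> int \<Rightarrow> ('v set \<Rightarrow> 'k::field) set" where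
  "boundaries \<Delta> i = boundary \<Delta> ` simplicial_chains \<Delta> (i + 1)"

definition homologous ::
  "'v::linorder set set \<Rightarrow> int \<Rightarrow> (('v set \<Rightarrow> 'k::field) \<times> ('v set \<Rightarrow> 'k)) set" where
  "homologous \<Delta> i = {(a, b). a \<in> cycles \<Delta> i \<and> b \<in> cycles \<Delta> i \<and> a - b \<in> boundaries \<Delta> i}"

abbreviation homology_class ::
  "'v::linorder set set \<Rightarrow> int \<Rightarrow> ('v set \<Rightarrow> 'k::field) \<Rightarrow> ('v set \<Rightarrow> 'k) set" where
  "homology_class \<Delta> i c \<equiv> homologous \<Delta> i `` {c}"

definition reduced_homology ::
  "'v::linorder set set \<Rightarrow> int \<Rightarrow> ('v set \<Rightarrow> 'k::field) set set" where
  "reduced_homology \<Delta> i = cycles \<Delta> i // homologous \<Delta> i"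

definition reduced_homology_zero :: "'k::field itself \<Rightarrow> 'v::linorder set set \<Rightarrow> int \<Rightarrow> bool" where
  "reduced_homology_zero K \<Delta> i \<longleftrightarrow>
     (reduced_homology \<Delta> i :: ('v set \<Rightarrow> 'k) set set) = {homology_class \<Delta> i 0}"

text \<open>
  Isomorphic to the one-dimensional space \<open>'k\<close>. The vector space operations of the quotient are
  those of representatives.
\<close>

definition reduced_homology_field :: "'k::field itself \<Rightarrow> 'v::linorder set set \<Rightarrow> int \<Rightarrow> bool" where
  "reduced_homology_field K \<Delta> i \<longleftrightarrow>
     (\<exists>\<phi> :: ('v set \<Rightarrow> 'k) set \<Rightarrow> 'k.
        bij_betw \<phi> (reduced_homology \<Delta> i) UNIV \<and>
        (\<forall>a\<in>cycles \<Delta> i. \<forall>b\<in>cycles \<Delta> i.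
           \<phi> (homology_class \<Delta> i (a + b)) = \<phi> (homology_class \<Delta> i a) + \<phi> (homology_class \<Delta> i b)) \<and>
        (\<forall>x. \<forall>a\<in>cycles \<Delta> i.
           \<phi> (homology_class \<Delta> i (\<lambda>f. x * a f)) = x * \<phi> (homology_class \<Delta> i a)))"

definition homology_sphere :: "'k::field itself \<Rightarrow> nat \<Rightarrow> 'v::linorder set set \<Rightarrow> bool" where
  "homology_sphere K d \<Delta> \<longleftrightarrow>
     pure_complex d \<Delta> \<and>
     (\<forall>f\<in>\<Delta>.
        (\<forall>i < int d - 1 - int (card f). reduced_homology_zero K (link \<Delta> f) i) \<and>
        reduced_homology_field K (link \<Delta> f) (int d - 1 - int (card f)))"

definition face_number :: "'v set set \<Rightarrow> nat \<Rightarrow> nat" where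
  "face_number \<Delta> i = card {f \<in> \<Delta>. card f = i}"

definition h_polynomial :: "nat \<Rightarrow> 'v set set \<Rightarrow> int poly" where
  "h_polynomial d \<Delta> = (\<Sum>i\<le>d. of_nat (face_number \<Delta> i) * [:- 1, 1:] ^ (d - i))"

text \<open>
  The polynomials \<open>z ^ i * (1 + z) ^ (d - 2 * i)\<close> are linearly independent, so at most one \<open>\<gamma>\<close>
  satisfies the following.
\<close>

definition is_gamma_polynomial :: "nat \<Rightarrow> 'v set set \<Rightarrow> int poly \<Rightarrow> bool" where
  "is_gamma_polynomial d \<Delta> \<gamma> \<longleftrightarrow>
     degree \<gamma> \<le> d div 2 \<and>
     h_polynomial d \<Delta> =
       (\<Sum>i\<le>d div 2. smult (coeff \<gamma> i) ([:0, 1:] ^ i * [:1, 1:] ^ (d - 2 * i)))"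

end

theory Submission imports Defs begin

text \<open>
  A flag complex is the clique complex of its graph. The only consequence of the sphere condition
  that matters is that links of ridges are two points and links of smaller faces are connected
  (a normal pseudomanifold). The join factors of such a complex are the components of the complement
  of its graph. If the complement is connected, some vertex link has the same property, so induction
  gives at least \<open>3d - 1\<close> vertices.

  Join factors with two vertices divide \<open>h\<close> by \<open>1 + z\<close> and leave \<open>\<gamma>\<close> unchanged. A pentagon
  factor contributes \<open>1 + 3z + z\<^sup>2\<close> to \<open>h\<close>, hence a factor \<open>1 + t\<close> to \<open>\<gamma>\<close>, which \<open>p\<close> does not
  have. Without either, the number \<open>n\<close> of vertices satisfies \<open>3n \<ge> 8d\<close>. Since \<open>n = 2d + k + 1\<close>
  and \<open>d \<ge> 2k \<ge> 6\<close>, equality holds with \<open>d = 6\<close> and \<open>k = 3\<close>, and the complex is the join of two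
  surfaces. Then the number of facets is even, whereas it has the parity of \<open>h(-1) = -\<gamma>\<^sub>3 = -1\<close>.
\<close>

section \<open>Gamma polynomials\<close>

text \<open>Since (z - 1)^(d - i) has degree d - i, only the empty face and the vertices reach
  degree d - 1.\<close>

lemma h_polynomial_coeff_linear:
  assumes "d \<ge> 2"
  shows "coeff (h_polynomial d \<Delta>) (d - 1) =
    int (face_number \<Delta> 1) - int d * int (face_number \<Delta> 0)"
proof -
  let ?a = "\<lambda>i. int (face_number \<Delta> i) * coeff ([:- 1, 1 :: int:] ^ (d - i)) (d - 1)"
  have "coeff (h_polynomial d \<Delta>) (d - 1) = (\<Sum>i\<le>d. ?a i)"
    by (simp add: h_polynomial_def coeff_sum of_nat_poly)
  also have "\<dots> = (\<Sum>i\<in>{0, 1}. ?a i)"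
  proof (rule sum.mono_neutral_right)
    show "\<forall>i\<in>{..d} - {0, 1}. ?a i = 0"
      using assms by (auto intro!: coeff_eq_0 simp: degree_linear_power)
  qed (use assms in auto)
  also have "\<dots> = ?a 0 + ?a 1" by simp
  also have "coeff ([:- 1, 1 :: int:] ^ (d - 0)) (d - 1) = - int d"
    using assms binomial_symmetric[of "d - 1" d] by (subst coeff_linear_poly_power) auto
  also have "coeff ([:- 1, 1 :: int:] ^ (d - 1)) (d - 1) = 1"
    by (rule coeff_linear_power)
  finally show ?thesis using assms by (simp add: mult.commute)
qed

text \<open>The summand z^i (1 + z)^(d - 2i) has degree d - i, so only i = 0 and i = 1 contribute to
  degree d - 1. When \<open>coeff \<gamma> 0\<close> and the number of empty faces are both 1, this
  determines the number of vertices as 2d + \<open>coeff \<gamma> 1\<close>.\<close>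

lemma gamma_coeff_1:
  assumes "is_gamma_polynomial d \<Delta> \<gamma>" "d \<ge> 2"
  shows "int (face_number \<Delta> 1) - int d * int (face_number \<Delta> 0) = int d * coeff \<gamma> 0 + coeff \<gamma> 1"
proof -
  let ?p = "\<lambda>i. [:0, 1 :: int:] ^ i * [:1, 1:] ^ (d - 2 * i)"
  have p: "coeff (?p i) (d - 1) =
      (if d - 1 < i then 0 else coeff ([:1, 1 :: int:] ^ (d - 2 * i)) (d - 1 - i))" for i
    using coeff_monom_mult[of "1 :: int" i] by (simp add: monom_altdef)
  have "coeff (h_polynomial d \<Delta>) (d - 1) = (\<Sum>i\<le>d div 2. coeff \<gamma> i * coeff (?p i) (d - 1))"
    using assms(1) by (simp add: is_gamma_polynomial_def coeff_sum)
  also have "\<dots> = (\<Sum>i\<in>{0, 1}. coeff \<gamma> i * coeff (?p i) (d - 1))"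
  proof (rule sum.mono_neutral_right)
    show "\<forall>i\<in>{..d div 2} - {0, 1}. coeff \<gamma> i * coeff (?p i) (d - 1) = 0"
    proof
      fix i assume "i \<in> {..d div 2} - {0, 1}"
      then have "degree ([:1, 1 :: int:] ^ (d - 2 * i)) < d - 1 - i"
        using assms(2) by (auto simp: degree_linear_power)
      then show "coeff \<gamma> i * coeff (?p i) (d - 1) = 0" unfolding p by (simp add: coeff_eq_0)
    qed
  qed (use assms in auto)
  also have "\<dots> = coeff \<gamma> 0 * coeff (?p 0) (d - 1) + coeff \<gamma> 1 * coeff (?p 1) (d - 1)"
    by simp
  also have "coeff (?p 0) (d - 1) = int d"
    unfolding p using assms binomial_symmetric[of "d - 1" d] by (subst coeff_linear_poly_power) auto
  also have "coeff (?p 1) (d - 1) = 1"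
  proof -
    have "coeff ([:1, 1 :: int:] ^ (d - 2)) (d - 2) = 1" by (rule coeff_linear_power)
    moreover have "d - 1 - 1 = d - 2" by simp
    ultimately show ?thesis unfolding p using assms(2) by simp
  qed
  finally show ?thesis using h_polynomial_coeff_linear[OF assms(2), of \<Delta>] by (simp add: mult.commute)
qed

text \<open>At z = -1 every summand with a positive power of 1 + z vanishes; the middle one survives
  as \<open>0 ^ 0 = 1\<close>.\<close>

lemma poly_h_polynomial_minus_one:
  assumes "is_gamma_polynomial (2 * m) \<Delta> \<gamma>"
  shows "poly (h_polynomial (2 * m) \<Delta>) (- 1) = coeff \<gamma> m * (- 1) ^ m"
proof -
  have "poly (h_polynomial (2 * m) \<Delta>) (- 1) =
      (\<Sum>i\<le>m. coeff \<gamma> i * ((- 1) ^ i * 0 ^ (2 * m - 2 * i)))"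
    using assms by (simp add: is_gamma_polynomial_def poly_sum)
  also have "\<dots> = (\<Sum>i\<in>{m}. coeff \<gamma> i * ((- 1) ^ i * 0 ^ (2 * m - 2 * i)))"
    by (rule sum.mono_neutral_right) auto
  finally show ?thesis by simp
qed

text \<open>Each summand with 2i \<le> d contains a factor 1 + z, which cancels. The degree bound
  drops when d is odd; then the middle coefficient vanishes because h has the root -1.\<close>

lemma is_gamma_polynomial_suspension:
  assumes gamma: "is_gamma_polynomial (Suc d) \<Delta> \<gamma>"
    and h: "h_polynomial (Suc d) \<Delta> = [:1, 1:] * h_polynomial d \<Delta>'"
  shows "is_gamma_polynomial d \<Delta>' \<gamma>"
proof -
  let ?p = "\<lambda>d i. smult (coeff \<gamma> i) ([:0, 1:] ^ i * [:1, 1 :: int:] ^ (d - 2 * i))"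
  have deg: "degree \<gamma> \<le> d div 2"
  proof (cases "even d")
    case True
    then show ?thesis using gamma by (simp add: is_gamma_polynomial_def)
  next
    case False
    then obtain m where m: "Suc d = 2 * Suc m" by (auto elim!: oddE)
    have "coeff \<gamma> (Suc m) * (- 1) ^ Suc m = poly (h_polynomial (Suc d) \<Delta>) (- 1)"
      using poly_h_polynomial_minus_one[of "Suc m" \<Delta> \<gamma>] gamma unfolding m by simp
    also have "\<dots> = 0" unfolding h by simp
    finally have "coeff \<gamma> (Suc m) = 0" by simp
    moreover have "degree \<gamma> \<le> Suc m"
      using gamma unfolding is_gamma_polynomial_def m by simp
    ultimately have "degree \<gamma> \<le> m"
      by (metis degree_0 eq_zero_or_degree_less le_zero_eq less_Suc_eq_le linorder_le_cases zero_le)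
    then show ?thesis using m by simp
  qed
  have "(\<Sum>i\<le>Suc d div 2. ?p (Suc d) i) = (\<Sum>i\<le>d div 2. ?p (Suc d) i)"
    using deg by (intro sum.mono_neutral_right) (auto simp: coeff_eq_0)
  also have "\<dots> = (\<Sum>i\<le>d div 2. [:1, 1:] * ?p d i)"
  proof (rule sum.cong)
    fix i assume "i \<in> {..d div 2}"
    then have "Suc d - 2 * i = Suc (d - 2 * i)" by auto
    then show "?p (Suc d) i = [:1, 1:] * ?p d i"
      by (simp only: power_Suc mult_smult_right mult.left_commute)
  qed simp
  also have "\<dots> = [:1, 1:] * (\<Sum>i\<le>d div 2. ?p d i)" by (simp only: sum_distrib_left)
  finally have "[:1, 1:] * h_polynomial d \<Delta>' = [:1, 1:] * (\<Sum>i\<le>d div 2. ?p d i)"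
    using gamma h by (simp only: is_gamma_polynomial_def)
  then have "h_polynomial d \<Delta>' = (\<Sum>i\<le>d div 2. ?p d i)"
    by (subst (asm) mult_cancel_left) simp
  then show ?thesis using deg by (simp add: is_gamma_polynomial_def)
qed

lemma dvd_power_diff: "(x :: 'a :: comm_ring_1) - y dvd x ^ n - y ^ n"
  by (simp add: power_diff_sumr2)

text \<open>
  Modulo \<open>1 + 3z + z\<^sup>2\<close> one has \<open>(1 + z)(2 + z) = 1\<close> and \<open>z(2 + z)\<^sup>2 = -1\<close>, so multiplying
  \<open>z\<^sup>i(1 + z)\<^sup>d\<^sup>-\<^sup>2\<^sup>i\<close> by \<open>(2 + z)\<^sup>d\<close> gives \<open>(-1)\<^sup>i\<close>.
\<close>

lemma gamma_minus_one_if_pentagon_dvd: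
  assumes "is_gamma_polynomial d \<Delta> \<gamma>" "[:1, 3, 1:] dvd h_polynomial d \<Delta>"
  shows "poly \<gamma> (- 1) = 0"
proof -
  let ?q = "[:1, 3, 1 :: int:]"
  let ?u = "[:2, 1 :: int:]"
  let ?a = "[:0, 1:] * ?u ^ 2" and ?b = "[:1, 1:] * ?u"
  have a: "?q dvd ?a - (- 1)"
    \<comment> \<open>The cofactor comes from z(2 + z)^2 + 1 = (1 + z)(1 + 3z + z^2).\<close>
    by (rule dvdI[of _ _ "[:1, 1:]"]) (simp add: power2_eq_square one_pCons)
  have b: "?q dvd ?b - 1"
    by (rule dvdI[of _ _ 1]) (simp add: one_pCons)
  have summand: "?q dvd [:0, 1:] ^ i * [:1, 1:] ^ (d - 2 * i) * ?u ^ d - (- 1) ^ i"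
    if "i \<le> d div 2" for i
  proof -
    have "2 * i + (d - 2 * i) = d" using that by auto
    then have u: "?u ^ d = (?u ^ 2) ^ i * ?u ^ (d - 2 * i)" by (metis power_add power_mult)
    have "[:0, 1:] ^ i * [:1, 1:] ^ (d - 2 * i) * ?u ^ d = ?a ^ i * ?b ^ (d - 2 * i)"
      unfolding u by (simp only: power_mult_distrib ac_simps)
    also have "\<dots> - (- 1) ^ i = ?a ^ i * (?b ^ (d - 2 * i) - 1 ^ (d - 2 * i)) + (?a ^ i - (- 1) ^ i)"
      by (simp add: right_diff_distrib)
    also have "?q dvd \<dots>"
      using dvd_trans[OF a dvd_power_diff] dvd_trans[OF b dvd_power_diff]
      by (intro dvd_add dvd_mult) blast+
    finally show ?thesis .
  qed
  have deg: "degree \<gamma> \<le> d div 2" using assms(1) by (simp add: is_gamma_polynomial_def)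
  \<comment> \<open>Summed up, h(z)(2 + z)^d is congruent to the constant \<gamma>(-1) modulo
    \<open>?q\<close>. As \<open>?q\<close> divides h, it divides this constant, which is then 0 for
    reasons of degree.\<close>
  have "?q dvd (\<Sum>i\<le>d div 2. smult (coeff \<gamma> i)
      ([:0, 1:] ^ i * [:1, 1:] ^ (d - 2 * i) * ?u ^ d - (- 1) ^ i))"
    using summand by (intro dvd_sum dvd_smult) auto
  also have "\<dots> = h_polynomial d \<Delta> * ?u ^ d - (\<Sum>i\<le>d div 2. smult (coeff \<gamma> i) ((- 1) ^ i))"
    using assms(1)
    by (simp add: is_gamma_polynomial_def smult_diff_right sum_subtractf sum_distrib_right)
  finally have "?q dvd (\<Sum>i\<le>d div 2. smult (coeff \<gamma> i) ((- 1) ^ i))"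
    using assms(2) by (metis dvd_diff_commute dvd_diff_right_iff dvd_mult2)
  also have "(\<Sum>i\<le>d div 2. smult (coeff \<gamma> i) ((- 1) ^ i)) = [:\<Sum>i\<le>d div 2. coeff \<gamma> i * (- 1) ^ i:]"
  proof -
    have "(- 1 :: int poly) = [:- 1:]" by (simp add: one_pCons)
    then have "smult c ((- 1) ^ i) = [:c * (- 1) ^ i:]" for c :: int and i
      by (simp only: poly_const_pow) simp
    then show ?thesis
      by (intro poly_eqI) (auto simp: coeff_sum coeff_pCons split: nat.splits)
  qed
  also have "(\<Sum>i\<le>d div 2. coeff \<gamma> i * (- 1) ^ i) = poly \<gamma> (- 1)"
    using deg unfolding poly_altdef by (intro sum.mono_neutral_right) (auto simp: coeff_eq_0)
  finally have dvd: "?q dvd [:poly \<gamma> (- 1):]" .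
  show ?thesis
  proof (rule ccontr)
    assume "poly \<gamma> (- 1) \<noteq> 0"
    then have "degree ?q \<le> degree [:poly \<gamma> (- 1):]" using dvd by (intro dvd_imp_degree_le) auto
    then show False by simp
  qed
qed

section \<open>Normal flag pseudomanifolds\<close>

text \<open>Connectedness in terms of cuts; the empty set counts as connected. In this form it
  follows directly from a homology computation, and its failure for the non-adjacency relation is
  exactly a decomposition as a join.\<close>

definition conn :: "('a \<Rightarrow> 'a \<Rightarrow> bool) \<Rightarrow> 'a set \<Rightarrow> bool" where
  "conn R X \<longleftrightarrow> (\<forall>S. S \<noteq> {} \<and> S \<subset> X \<longrightarrow> (\<exists>a\<in>S. \<exists>b\<in>X - S. R a b))"

lemma conn_insert:
  assumes "conn R A" "symp R" "a \<in> A" "R a w"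
  shows "conn R (insert w A)"
  unfolding conn_def
proof (intro allI impI)
  fix S assume S: "S \<noteq> {} \<and> S \<subset> insert w A"
  have sym: "R w a" using assms by (auto dest: sympD)
  show "\<exists>a\<in>S. \<exists>b\<in>insert w A - S. R a b"
  proof (cases "S \<inter> A \<noteq> {} \<and> S \<inter> A \<subset> A")
    case True
    then obtain x y where "x \<in> S \<inter> A" "y \<in> A - S \<inter> A" "R x y"
      using assms(1) unfolding conn_def by meson
    then show ?thesis by blast
  next
    case False
    then consider "S \<inter> A = {}" | "A \<subseteq> S" by blast
    then show ?thesis
    proof cases
      case 1
      then have "S = {w}" using S by blast
      then show ?thesis using 1 sym assms(3) by blast
    next
      case 2
      then show ?thesis using S assms(3,4) by blast
    qed
  qed
qed

lemma greatest_card_subset: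
  assumes "finite X" "P A\<^sub>0" "\<And>A. P A \<Longrightarrow> A \<subseteq> X"
  obtains A where "P A" "\<And>B. P B \<Longrightarrow> card B \<le> card A"
proof -
  have "\<forall>A. P A \<longrightarrow> card A < Suc (card X)"
    using assms by (auto simp: less_Suc_eq_le intro: card_mono)
  then have "\<exists>A. P A \<and> (\<forall>B. P B \<longrightarrow> card B \<le> card A)"
    using ex_has_greatest_nat[of P A\<^sub>0 card "Suc (card X)"] assms(2) by blast
  then show ?thesis using that by auto
qed

section \<open>Cliques, links and normal pseudomanifolds of a graph\<close>

locale adjacency =
  fixes E :: "'v \<Rightarrow> 'v \<Rightarrow> bool"
  assumes E_sym: "E x y \<Longrightarrow> E y x" and E_irrefl: "\<not> E x x"
begin

lemma E_commute: "E x y \<longleftrightarrow> E y x"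
  using E_sym by blast

text \<open>The link of a clique \<open>f\<close> in the clique complex on \<open>X\<close> is the
  clique complex on this set, so passing to links only changes the vertex set.\<close>

definition nbrs :: "'v set \<Rightarrow> 'v set \<Rightarrow> 'v set" where
  "nbrs f X = {x \<in> X. \<forall>y\<in>f. E x y}"

definition clique :: "'v set \<Rightarrow> bool" where
  "clique f \<longleftrightarrow> (\<forall>x\<in>f. \<forall>y\<in>f. x \<noteq> y \<longrightarrow> E x y)"

definition clique_complex :: "'v set \<Rightarrow> 'v set set" where
  "clique_complex X = {f. f \<subseteq> X \<and> clique f}"

text \<open>
  The clique complex of the graph on \<open>X\<close> is a normal pseudomanifold of dimension \<open>d - 1\<close>; the
  recursion is over vertex links.
\<close>

fun npm :: "nat \<Rightarrow> 'v set \<Rightarrow> bool" where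
  "npm 0 X \<longleftrightarrow> X = {}"
| "npm (Suc 0) X \<longleftrightarrow> card X = 2 \<and> (\<forall>x\<in>X. \<forall>y\<in>X. \<not> E x y)"
| "npm (Suc (Suc d)) X \<longleftrightarrow>
     finite X \<and> X \<noteq> {} \<and> conn E X \<and> (\<forall>x\<in>X. npm (Suc d) (nbrs {x} X))"

abbreviation coconn :: "'v set \<Rightarrow> bool" where
  "coconn \<equiv> conn (\<lambda>x y. \<not> E x y)"

text \<open>Disjointness of the two sides follows from irreflexivity of \<open>E\<close>. A side may
  be empty, so \<open>X\<close> is a factor of itself.\<close>

abbreviation is_join :: "'v set \<Rightarrow> 'v set \<Rightarrow> 'v set \<Rightarrow> bool" where
  "is_join X A B \<equiv> X = A \<union> B \<and> (\<forall>a\<in>A. \<forall>b\<in>B. E a b)"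

lemma npm_finite: "npm d X \<Longrightarrow> finite X"
  by (cases "(d, X)" rule: npm.cases) (auto intro: card_ge_0_finite)

lemma npm_nonempty: "npm (Suc d) X \<Longrightarrow> X \<noteq> {}"
  by (cases d) auto

lemma npm_nbrs_vertex: "npm (Suc d) X \<Longrightarrow> x \<in> X \<Longrightarrow> npm d (nbrs {x} X)"
  by (cases d) (auto simp: nbrs_def)

lemma nbrs_insert: "nbrs (insert x f) X = nbrs f (nbrs {x} X)"
  by (auto simp: nbrs_def)

lemma clique_subset: "clique f \<Longrightarrow> g \<subseteq> f \<Longrightarrow> clique g"
  by (auto simp: clique_def)

lemma clique_insert: "clique (insert x f) \<longleftrightarrow> clique f \<and> (\<forall>y\<in>f. y \<noteq> x \<longrightarrow> E x y)"
  by (auto simp: clique_def intro: E_sym)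

lemma npm_nbrs:
  assumes "finite f" "npm d X" "f \<subseteq> X" "clique f"
  shows "card f \<le> d \<and> npm (d - card f) (nbrs f X)"
  using assms
proof (induction f arbitrary: d X rule: finite_induct)
  case empty
  then show ?case by (simp add: nbrs_def)
next
  case (insert x f)
  then obtain e where d: "d = Suc e" by (cases d) auto
  have "npm e (nbrs {x} X)" using insert d npm_nbrs_vertex by auto
  moreover have "f \<subseteq> nbrs {x} X" "clique f"
    using insert by (auto simp: nbrs_def clique_insert intro!: E_sym[of x])
  ultimately have "card f \<le> e \<and> npm (e - card f) (nbrs f (nbrs {x} X))"
    using insert.IH by blast
  then show ?case using insert.hyps d by (simp only: nbrs_insert[of x f X]) simp
qed

text \<open>This is purity: an empty link has to be a pseudomanifold for the parameter 0, the only
  one that allows an empty vertex set.\<close>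

lemma npm_maximal_clique:
  assumes "npm d X" "f \<subseteq> X" "clique f" "nbrs f X = {}"
  shows "card f = d"
proof -
  have "card f \<le> d" "npm (d - card f) {}"
    using npm_nbrs[of f d X] assms npm_finite finite_subset by metis+
  then show ?thesis using npm_nonempty[of _ "{}"] by (cases "d - card f") auto
qed

lemma maximal_clique_exists:
  assumes "finite X"
  obtains f where "f \<subseteq> X" "clique f" "nbrs f X = {}"
proof -
  let ?P = "\<lambda>f. f \<subseteq> X \<and> clique f"
  have "?P {}" by (simp add: clique_def)
  then obtain f where f: "?P f" "\<And>g. ?P g \<Longrightarrow> card g \<le> card f"
    by (rule greatest_card_subset[OF assms, of ?P "{}"]) auto
  have "nbrs f X = {}"
  proof (rule ccontr)
    assume "nbrs f X \<noteq> {}"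
    then obtain x where x: "x \<in> X" "\<forall>y\<in>f. E x y" by (auto simp: nbrs_def)
    then have "?P (insert x f)" using f(1) by (auto simp: clique_insert)
    moreover have "x \<notin> f" using x E_irrefl by blast
    ultimately show False using f assms finite_subset
      by (metis card_insert_disjoint lessI not_less)
  qed
  then show ?thesis using that f(1) by blast
qed

text \<open>No vertex is a cone point: passing to the link of a neighbour keeps \<open>x\<close> and
  lowers the dimension, until \<open>x\<close> is one of two isolated points.\<close>

lemma npm_nonneighbour:
  assumes "npm d X" "x \<in> X"
  shows "\<exists>z\<in>X. z \<noteq> x \<and> \<not> E x z"
  using assms
proof (induction d X rule: npm.induct)
  case (2 X)
  then have "X \<noteq> {x}" by auto
  then show ?case using 2 by fastforce
next
  case (3 d X)
  then have "npm (Suc d) (nbrs {x} X)" by simp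
  then have "nbrs {x} X \<noteq> {}" by (rule npm_nonempty)
  then obtain b where b: "b \<in> X" "E x b" by (auto simp: nbrs_def E_commute)
  then have "npm (Suc d) (nbrs {b} X)" "x \<in> nbrs {b} X"
    using 3 by (auto simp: nbrs_def)
  then show ?case using "3.IH"[of b] b by (auto simp: nbrs_def)
qed simp

section \<open>The number of vertices of a co-connected complex\<close>

text \<open>
  Take a largest co-connected \<open>A\<close> with a nonempty set \<open>Y\<close> of common neighbours, and let \<open>N\<close> be the
  remaining vertices. By maximality no edge joins \<open>N\<close> to \<open>Y\<close>. If \<open>\<rho>\<close> is a largest clique of \<open>A\<close> with
  a common neighbour in \<open>N\<close>, then its link has no edge from \<open>N\<close> to the rest, so it is disconnected and
  hence consists of two points; thus \<open>Y\<close> is a single vertex, with neighbourhood \<open>A\<close>.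
\<close>

lemma coconnected_link_exists:
  assumes npm: "npm (Suc (Suc d)) X" and co: "coconn X"
  shows "\<exists>y\<in>X. coconn (nbrs {y} X)"
proof -
  have fin: "finite X" using npm npm_finite by blast
  let ?P = "\<lambda>A. A \<subseteq> X \<and> A \<noteq> {} \<and> coconn A \<and> nbrs A X \<noteq> {}"
  obtain v where v: "v \<in> X" using npm by auto
  then have "npm (Suc d) (nbrs {v} X)" using npm by simp
  then have "?P {v}" using v npm_nonempty by (auto simp: conn_def)
  then obtain A where A: "?P A" and A_max: "\<And>B. ?P B \<Longrightarrow> card B \<le> card A"
    by (rule greatest_card_subset[OF fin, of ?P "{v}"]) auto
  define Y where "Y = nbrs A X"
  define N where "N = X - A - Y"
  have YX: "Y \<subseteq> X" "Y \<inter> A = {}" using A E_irrefl by (auto simp: Y_def nbrs_def)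
  have YA: "E y a" if "y \<in> Y" "a \<in> A" for y a using that by (auto simp: Y_def nbrs_def)
  have NY: "\<not> E w y" if w: "w \<in> N" and y: "y \<in> Y" for w y
  proof
    assume wy: "E w y"
    obtain a where a: "a \<in> A" "\<not> E w a"
      using w unfolding N_def Y_def nbrs_def by blast
    have "coconn (insert w A)"
      by (rule conn_insert[of _ A a]) (use A a E_commute in \<open>auto simp: symp_def\<close>)
    moreover have "y \<in> nbrs (insert w A) X"
      using wy y by (auto simp: Y_def nbrs_def E_commute)
    ultimately have "?P (insert w A)" using A w by (auto simp: N_def)
    then have "card (insert w A) \<le> card A" by (rule A_max)
    moreover have "w \<notin> A" "finite A" using w A finite_subset[OF _ fin] by (auto simp: N_def)
    ultimately show False by simp
  qed
  obtain y where y: "y \<in> Y" using A by (auto simp: Y_def)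
  \<comment> \<open>Otherwise \<open>X\<close> would be the join of \<open>A\<close> and the
    nonempty \<open>Y\<close>, contrary to co-connectedness.\<close>
  have "N \<noteq> {}"
  proof
    assume "N = {}"
    then have "X = A \<union> Y" using A YX by (auto simp: N_def)
    then have "A \<subset> X" using y YX by auto
    then obtain a b where "a \<in> A" "b \<in> X - A" "\<not> E a b"
      using co A unfolding conn_def by meson
    then show False using \<open>X = A \<union> Y\<close> YA E_sym by blast
  qed
  let ?Q = "\<lambda>\<rho>. \<rho> \<subseteq> A \<and> clique \<rho> \<and> nbrs \<rho> N \<noteq> {}"
  have "?Q {}" using \<open>N \<noteq> {}\<close> by (auto simp: clique_def nbrs_def)
  then obtain \<rho> where \<rho>: "?Q \<rho>" and \<rho>_max: "\<And>\<sigma>. ?Q \<sigma> \<Longrightarrow> card \<sigma> \<le> card \<rho>"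
    by (rule greatest_card_subset[OF fin, of ?Q "{}"]) (use A in auto)
  let ?L = "nbrs \<rho> X"
  have fin\<rho>: "finite \<rho>" using \<rho> A finite_subset[OF _ fin] by blast
  have L: "npm (Suc (Suc d) - card \<rho>) ?L"
    using npm_nbrs[of \<rho> "Suc (Suc d)" X] fin\<rho> npm \<rho> A by blast
  have YL: "Y \<subseteq> ?L" using YA YX \<rho> by (auto simp: nbrs_def)
  have AN: "\<not> E a w" if "a \<in> A \<inter> ?L" "w \<in> N \<inter> ?L" for a w
  proof
    assume "E a w"
    then have "w \<in> nbrs (insert a \<rho>) N" using that by (auto simp: nbrs_def E_commute)
    then have "?Q (insert a \<rho>)" using that \<rho> by (auto simp: nbrs_def clique_insert)
    then have "card (insert a \<rho>) \<le> card \<rho>" by (rule \<rho>_max)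
    moreover have "a \<notin> \<rho>" using that E_irrefl by (auto simp: nbrs_def)
    ultimately show False using fin\<rho> by simp
  qed
  obtain w where w: "w \<in> N" "w \<in> ?L" using \<rho> by (auto simp: nbrs_def N_def)
  have "\<not> conn E ?L"
  proof
    assume "conn E ?L"
    moreover have "N \<inter> ?L \<noteq> {}" "N \<inter> ?L \<subset> ?L" using w YL y by (auto simp: N_def)
    ultimately obtain a b where ab: "a \<in> N \<inter> ?L" "b \<in> ?L - N \<inter> ?L" "E a b"
      unfolding conn_def by meson
    then have "b \<in> A \<or> b \<in> Y" by (auto simp: N_def nbrs_def)
    then show False using ab NY AN E_sym by blast
  qed
  moreover have "?L \<noteq> {}" using w by blast
  ultimately have "npm (Suc 0) ?L"
    using L npm.simps(1,3) by (metis not0_implies_Suc)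
  then have L2: "card ?L = 2" and L_indep: "\<And>x y. x \<in> ?L \<Longrightarrow> y \<in> ?L \<Longrightarrow> \<not> E x y"
    by auto
  have "{y, w} \<subseteq> ?L" "y \<noteq> w" using y w YL by (auto simp: N_def)
  then have "?L = {y, w}" using L2
    by (metis card_2_iff card_subset_eq card.infinite zero_neq_numeral)
  then have "Y = {y}" using YL w y by (auto simp: N_def)
  have "x \<in> A" if "x \<in> X" "E x y" for x
    using that NY[of x y] \<open>Y = {y}\<close> E_irrefl by (auto simp: N_def)
  then have "nbrs {y} X = A"
    using YA[OF y] A by (auto simp: nbrs_def E_commute)
  then show ?thesis using A y YX by auto
qed

text \<open>A vertex \<open>y\<close> with co-connected link has at least two non-neighbours besides
  itself, so each dimension costs three vertices outside the link.\<close>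

theorem coconnected_card_ge:
  assumes "npm (Suc d) X" "coconn X"
  shows "3 * d + 2 \<le> card X"
  using assms
proof (induction d arbitrary: X)
  case (Suc d)
  then obtain y where y: "y \<in> X" "coconn (nbrs {y} X)"
    using coconnected_link_exists by blast
  let ?L = "nbrs {y} X"
  have L: "npm (Suc d) ?L" using Suc y by simp
  then have IH: "3 * d + 2 \<le> card ?L" using Suc y by blast
  have fin: "finite X" using Suc npm_finite by blast
  have L_ne: "?L \<noteq> {}" using L npm_nonempty by blast
  obtain w where w: "w \<in> X" "w \<noteq> y" "\<not> E y w" using npm_nonneighbour Suc y by blast
  have "{y, w} \<subset> X" using L_ne w y by (auto simp: nbrs_def E_irrefl E_commute)
  then obtain a b where ab: "a \<in> {y, w}" "b \<in> X - {y, w}" "\<not> E a b"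
    using Suc.prems(2) unfolding conn_def by (metis insert_not_empty)
  \<comment> \<open>A second non-neighbour of \<open>y\<close>: either \<open>b\<close> itself, or
    else \<open>b\<close> is adjacent to \<open>y\<close> and not to \<open>w\<close>. In the latter
    case \<open>y\<close> has a non-neighbour \<open>u\<close> in the link of \<open>b\<close>, and
    \<open>u\<close> differs from \<open>w\<close> because \<open>w\<close> is not in that
    link.\<close>
  have "\<exists>u\<in>X. u \<noteq> y \<and> u \<noteq> w \<and> \<not> E y u"
  proof (cases "E y b")
    case False
    then show ?thesis using ab by blast
  next
    case True
    then have "npm (Suc d) (nbrs {b} X)" "y \<in> nbrs {b} X"
      using Suc ab y by (auto simp: nbrs_def)
    then obtain u where "u \<in> nbrs {b} X" "u \<noteq> y" "\<not> E y u"
      using npm_nonneighbour by blast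
    then show ?thesis using ab True by (auto simp: nbrs_def)
  qed
  then obtain u where u: "u \<in> X" "u \<noteq> y" "u \<noteq> w" "\<not> E y u" by blast
  have "card (?L \<union> {y, w, u}) = card ?L + card {y, w, u}"
    using w u fin by (intro card_Un_disjoint) (auto simp: nbrs_def E_irrefl E_commute)
  moreover have "?L \<union> {y, w, u} \<subseteq> X" using w u y by (auto simp: nbrs_def)
  ultimately show ?case using card_mono[OF fin, of "?L \<union> {y, w, u}"] IH w u by simp
qed simp

section \<open>Joins and their h-polynomials\<close>

lemma clique_complex_finite: "finite X \<Longrightarrow> finite (clique_complex X)"
  by (simp add: clique_complex_def)

lemma is_join_commute: "is_join X A B \<longleftrightarrow> is_join X B A"
  by (auto intro: E_sym)

lemma is_join_disjoint: "is_join X A B \<Longrightarrow> A \<inter> B = {}"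
  using E_irrefl by blast

text \<open>The factor \<open>B\<close> is the link in \<open>X\<close> of any maximal clique of
  \<open>A\<close>, and such a clique has \<open>a\<close> elements.\<close>

lemma npm_join_factor:
  assumes "npm d X" "is_join X A B" "npm a A"
  shows "a \<le> d \<and> npm (d - a) B"
proof -
  obtain \<sigma> where \<sigma>: "\<sigma> \<subseteq> A" "clique \<sigma>" "nbrs \<sigma> A = {}"
    using maximal_clique_exists npm_finite assms(3) by metis
  then have "card \<sigma> = a" using npm_maximal_clique assms(3) by blast
  moreover have joined: "\<forall>b\<in>B. \<forall>y\<in>\<sigma>. E b y" using \<sigma>(1) assms(2) E_sym by blast
  have "nbrs \<sigma> X = B"
    using \<sigma>(3) joined assms(2) by (auto simp: nbrs_def)
  moreover have "finite \<sigma>" "\<sigma> \<subseteq> X"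
    using \<sigma>(1) assms(2) finite_subset[OF _ npm_finite[OF assms(3)]] by auto
  ultimately show ?thesis using npm_nbrs \<sigma> assms(1) by blast
qed

text \<open>The factor \<open>A\<close> is the link of a maximal clique of \<open>B\<close>, hence a
  pseudomanifold; this in turn makes \<open>npm_join_factor\<close> applicable to
  \<open>B\<close>.\<close>

lemma npm_join_split:
  assumes "npm d X" "is_join X A B"
  obtains a b where "npm a A" "npm b B" "d = a + b"
proof -
  have "finite B" using npm_finite[OF assms(1)] assms(2) by simp
  then obtain \<sigma> where \<sigma>: "\<sigma> \<subseteq> B" "clique \<sigma>" "nbrs \<sigma> B = {}"
    using maximal_clique_exists by metis
  have "nbrs \<sigma> X = A"
    using \<sigma> assms(2) by (auto simp: nbrs_def)
  moreover have "finite \<sigma>" "\<sigma> \<subseteq> X"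
    using \<sigma> assms(2) finite_subset[OF _ \<open>finite B\<close>] by auto
  ultimately have "npm (d - card \<sigma>) A" "card \<sigma> \<le> d"
    using npm_nbrs[of \<sigma> d X] \<sigma> assms(1) by auto
  then show ?thesis
    using that[of "d - card \<sigma>" "card \<sigma>"] npm_join_factor[OF assms, of "d - card \<sigma>"] by auto
qed

lemma card_face_le:
  assumes "npm d X" "f \<in> clique_complex X"
  shows "card f \<le> d"
  using npm_nbrs[OF _ assms(1), of f] finite_subset[OF _ npm_finite[OF assms(1)], of f] assms(2)
  by (auto simp: clique_complex_def)

text \<open>Summation over faces rather than cardinalities makes multiplicativity under joins a
  matter of reindexing.\<close>

lemma h_polynomial_face_sum:
  assumes "npm d X"
  shows "h_polynomial d (clique_complex X) = (\<Sum>f\<in>clique_complex X. [:- 1, 1:] ^ (d - card f))"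
proof -
  have "(\<Sum>f\<in>clique_complex X. [:- 1, 1 :: int:] ^ (d - card f)) =
      (\<Sum>i\<le>d. \<Sum>f | f \<in> clique_complex X \<and> card f = i. [:- 1, 1:] ^ (d - card f))"
    by (rule sum.group[symmetric])
      (use assms npm_finite clique_complex_finite card_face_le in auto)
  also have "\<dots> = h_polynomial d (clique_complex X)"
    unfolding h_polynomial_def face_number_def by (intro sum.cong) auto
  finally show ?thesis by simp
qed

lemma bij_betw_join:
  assumes "is_join X A B"
  shows "bij_betw (\<lambda>(f, g). f \<union> g) (clique_complex A \<times> clique_complex B) (clique_complex X)"
proof (rule bij_betw_byWitness[where f' = "\<lambda>h. (h \<inter> A, h \<inter> B)"])
  have "clique (f \<union> g)" if "f \<subseteq> A" "g \<subseteq> B" "clique f" "clique g" for f g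
  proof -
    have "\<forall>x\<in>f. \<forall>y\<in>g. E x y \<and> E y x" using that(1,2) assms E_sym by blast
    then show ?thesis using that(3,4) unfolding clique_def by blast
  qed
  then show "(\<lambda>(f, g). f \<union> g) ` (clique_complex A \<times> clique_complex B) \<subseteq> clique_complex X"
    using assms by (auto simp: clique_complex_def)
  show "(\<lambda>h. (h \<inter> A, h \<inter> B)) ` clique_complex X \<subseteq> clique_complex A \<times> clique_complex B"
    by (auto simp: clique_complex_def intro: clique_subset)
  show "\<forall>p\<in>clique_complex A \<times> clique_complex B.
      ((case p of (f, g) \<Rightarrow> f \<union> g) \<inter> A, (case p of (f, g) \<Rightarrow> f \<union> g) \<inter> B) = p"
    using is_join_disjoint[OF assms] by (auto simp: clique_complex_def)
  show "\<forall>h\<in>clique_complex X. (case (h \<inter> A, h \<inter> B) of (f, g) \<Rightarrow> f \<union> g) = h"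
    using assms by (auto simp: clique_complex_def)
qed

lemma h_polynomial_join:
  assumes "npm a A" "npm b B" "npm (a + b) X" "is_join X A B"
  shows "h_polynomial (a + b) (clique_complex X) =
    h_polynomial a (clique_complex A) * h_polynomial b (clique_complex B)"
proof -
  let ?z = "[:- 1, 1 :: int:]"
  \<comment> \<open>The bounds on \<open>card f\<close> and \<open>card g\<close> keep the truncated
    subtraction additive.\<close>
  have card: "a + b - card (f \<union> g) = (a - card f) + (b - card g)"
    if "f \<in> clique_complex A" "g \<in> clique_complex B" for f g
  proof -
    have "finite f" "finite g" "f \<inter> g = {}"
      using that finite_subset[OF _ npm_finite[OF assms(1)]]
        finite_subset[OF _ npm_finite[OF assms(2)]] is_join_disjoint[OF assms(4)]
      by (auto simp: clique_complex_def)
    then have "card (f \<union> g) = card f + card g" by (rule card_Un_disjoint)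
    then show ?thesis using card_face_le assms that by (simp add: le_diff_conv2)
  qed
  have "h_polynomial (a + b) (clique_complex X) =
      (\<Sum>p\<in>clique_complex A \<times> clique_complex B. case p of (f, g) \<Rightarrow> ?z ^ (a + b - card (f \<union> g)))"
    unfolding h_polynomial_face_sum[OF assms(3)]
      sum.reindex_bij_betw[OF bij_betw_join[OF assms(4)], symmetric]
    by (simp add: case_prod_unfold)
  also have "\<dots> = (\<Sum>(f, g)\<in>clique_complex A \<times> clique_complex B. ?z ^ (a - card f) * ?z ^ (b - card g))"
    by (intro sum.cong) (auto simp: card power_add)
  also have "\<dots> = h_polynomial a (clique_complex A) * h_polynomial b (clique_complex B)"
    unfolding h_polynomial_face_sum[OF assms(1)] h_polynomial_face_sum[OF assms(2)]
    by (simp add: sum_product sum.cartesian_product)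
  finally show ?thesis .
qed

section \<open>Face numbers, parity and the exceptional factors\<close>

lemma face_number_0: "finite X \<Longrightarrow> face_number (clique_complex X) 0 = 1"
proof -
  assume "finite X"
  then have "{f \<in> clique_complex X. card f = 0} = {{}}"
    by (auto simp: clique_complex_def clique_def dest: finite_subset)
  then show ?thesis by (simp add: face_number_def)
qed

lemma face_number_1: "face_number (clique_complex X) (Suc 0) = card X"
proof -
  have "{f \<in> clique_complex X. card f = Suc 0} = (\<lambda>x. {x}) ` X"
    by (auto simp: clique_complex_def clique_def card_1_singleton_iff)
  then show ?thesis by (simp add: face_number_def card_image)
qed

text \<open>Double counting of ridges in facets: a facet has \<open>Suc d\<close> ridges, and a
  ridge lies in two facets because its link consists of two points.\<close>

lemma face_number_ridge:
  assumes "npm (Suc d) X"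
  shows "Suc d * face_number (clique_complex X) (Suc d) = 2 * face_number (clique_complex X) d"
proof -
  have fin: "finite X" using assms npm_finite by blast
  let ?F = "\<lambda>i. {f \<in> clique_complex X. card f = i}"
  have finF: "finite (?F i)" for i using clique_complex_finite[OF fin] by simp
  have down: "card {g \<in> ?F d. g \<subseteq> f} = Suc d" if f: "f \<in> ?F (Suc d)" for f
  proof -
    have "{g \<in> ?F d. g \<subseteq> f} = {g. g \<subseteq> f \<and> card g = d}"
      using f clique_subset by (auto simp: clique_complex_def)
    moreover have "finite f" using f card.infinite by fastforce
    ultimately show ?thesis using n_subsets[of f d] f by simp
  qed
  have up: "card {f \<in> ?F (Suc d). g \<subseteq> f} = 2" if g: "g \<in> ?F d" for g
  proof -
    have fing: "finite g" using g fin finite_subset by (auto simp: clique_complex_def)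
    have "npm (Suc d - card g) (nbrs g X)"
      using npm_nbrs[OF fing assms] g by (auto simp: clique_complex_def)
    then have two: "card (nbrs g X) = 2" using g by simp
    have bij: "bij_betw (\<lambda>x. insert x g) (nbrs g X) {f \<in> ?F (Suc d). g \<subseteq> f}"
    proof (rule bij_betwI')
      show "x \<in> nbrs g X \<Longrightarrow> insert x g \<in> {f \<in> ?F (Suc d). g \<subseteq> f}" for x
        using g fing E_irrefl
        by (auto simp: nbrs_def clique_complex_def clique_insert card_insert_if)
      show "insert x g = insert y g \<longleftrightarrow> x = y" if "x \<in> nbrs g X" "y \<in> nbrs g X" for x y
        using that E_irrefl by (auto simp: nbrs_def)
      fix f assume f: "f \<in> {f \<in> ?F (Suc d). g \<subseteq> f}"
      then have "card (f - g) = 1" using g fing by (simp add: card_Diff_subset)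
      then obtain x where x: "f - g = {x}" by (auto simp: card_1_singleton_iff)
      then have "f = insert x g" "x \<notin> g" using f by auto
      then show "\<exists>x\<in>nbrs g X. f = insert x g"
        using f by (intro bexI[of _ x]) (auto simp: nbrs_def clique_complex_def clique_def)
    qed
    show ?thesis unfolding bij_betw_same_card[OF bij, symmetric] by (rule two)
  qed
  have "(\<Sum>g\<in>?F d. card {f \<in> ?F (Suc d). g \<subseteq> f}) = Suc d * card (?F (Suc d))"
    by (rule sum_multicount) (use finF down in auto)
  moreover have "(\<Sum>g\<in>?F d. card {f \<in> ?F (Suc d). g \<subseteq> f}) = 2 * card (?F d)"
    using up by (simp only: sum_constant cong: sum.cong) simp
  ultimately show ?thesis unfolding face_number_def by argo
qed

text \<open>At z = -1 the base z - 1 equals -2, so modulo 2 only the facets count.\<close>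

lemma even_poly_h_polynomial:
  "even (poly (h_polynomial d \<Delta>) (- 1)) \<longleftrightarrow> even (face_number \<Delta> d)"
proof -
  have "poly (h_polynomial d \<Delta>) (- 1) = (\<Sum>i\<le>d. int (face_number \<Delta> i) * (- 2) ^ (d - i))"
    by (simp add: h_polynomial_def poly_sum)
  also have "\<dots> = (\<Sum>i<d. int (face_number \<Delta> i) * (- 2) ^ (d - i)) + face_number \<Delta> d"
    by (cases d) (auto simp: lessThan_Suc_atMost[symmetric])
  moreover have "even (\<Sum>i<d. int (face_number \<Delta> i) * (- 2) ^ (d - i))"
    by (intro dvd_sum) auto
  ultimately show ?thesis by simp
qed

lemma h_polynomial_two_points:
  assumes "npm 1 A"
  shows "h_polynomial 1 (clique_complex A) = [:1, 1:]"
  using assms npm_finite[OF assms]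
  by (simp add: h_polynomial_def face_number_0 face_number_1 one_pCons numeral_poly)

lemma h_polynomial_pentagon:
  assumes "npm 2 A" "card A = 5"
  shows "h_polynomial 2 (clique_complex A) = [:1, 3, 1:]"
proof -
  have "face_number (clique_complex A) 2 = 5"
    using face_number_ridge[of 1 A] assms by (simp add: numeral_2_eq_2 face_number_1)
  then show ?thesis using assms(2) npm_finite[OF assms(1)]
    by (simp add: h_polynomial_def face_number_0 face_number_1 numeral_2_eq_2
        one_pCons numeral_poly)
qed

text \<open>Both sides of the inequality are additive under joins, so the co-connected case decides.
  There the bound 3d - 1 on the number of vertices exceeds 8d/3 for d > 3 and equals it for d = 3; d
  = 1 and the pentagon are excluded, and for d = 2 six vertices are more than enough.\<close>

theorem npm_factor_or_large:
  assumes "npm d X"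
    and "\<And>a A B. is_join X A B \<Longrightarrow> npm a A \<Longrightarrow> a \<noteq> 1 \<and> \<not> (a = 2 \<and> card A = 5)"
  shows "8 * d \<le> 3 * card X \<and>
    (d > 0 \<and> 3 * card X = 8 * d \<longrightarrow> even (poly (h_polynomial d (clique_complex X)) (- 1)))"
  using assms
proof (induction "card X" arbitrary: X d rule: less_induct)
  case less
  have fin: "finite X" using less npm_finite by blast
  show ?case
  proof (cases "coconn X")
    case True
    show ?thesis
    proof (cases d)
      case (Suc e)
      have large: "3 * e + 2 \<le> card X" using coconnected_card_ge True less Suc by blast
      \<comment> \<open>The hypothesis on factors is applied to \<open>X\<close> itself, joined with
        the empty set.\<close>
      have small: "d \<noteq> 1" "\<not> (d = 2 \<and> card X = 5)"
        using less.prems(2)[of X "{}" d] less.prems(1) by auto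
      \<comment> \<open>A closed surface has an even number of triangles, three times which is twice
        the number of edges.\<close>
      have "even (poly (h_polynomial d (clique_complex X)) (- 1))" if "d = 3"
      proof -
        have "3 * face_number (clique_complex X) 3 = 2 * face_number (clique_complex X) 2"
          using face_number_ridge[of 2 X] less.prems(1) that by (simp add: numeral_3_eq_3)
        then have "even (3 * face_number (clique_complex X) 3)" by simp
        then show ?thesis unfolding even_poly_h_polynomial that by simp
      qed
      moreover have "d = 3" if "3 * card X = 8 * d" using that large small Suc by presburger
      moreover have "8 * d \<le> 3 * card X" using large small Suc by presburger
      ultimately show ?thesis by blast
    qed (use less in simp)
  next
    case False
    then obtain A where A: "A \<noteq> {}" "A \<subset> X" "\<forall>a\<in>A. \<forall>b\<in>X - A. E a b"
      unfolding conn_def by blast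
    define B where "B = X - A"
    have join: "is_join X A B" using A by (auto simp: B_def)
    have join': "is_join X B A" by (rule iffD1[OF is_join_commute join])
    obtain a b where ab: "npm a A" "npm b B" "d = a + b"
      using npm_join_split less.prems(1) join by metis
    have "a > 0" using ab(1) A by (cases a) auto
    have card_less: "card A < card X" "card B < card X"
      using A fin by (auto simp: B_def intro!: psubset_card_mono)
    \<comment> \<open>A join factor of a factor is a factor of \<open>X\<close>, so the hypothesis
      is inherited.\<close>
    have A_factor: "a' \<noteq> 1 \<and> \<not> (a' = 2 \<and> card A' = 5)"
      if "is_join A A' B'" "npm a' A'" for a' A' B'
    proof (rule less.prems(2)[OF _ that(2)])
      show "is_join X A' (B' \<union> B)" using that(1) join by auto
    qed
    have B_factor: "a' \<noteq> 1 \<and> \<not> (a' = 2 \<and> card A' = 5)"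
      if "is_join B A' B'" "npm a' A'" for a' A' B'
    proof (rule less.prems(2)[OF _ that(2)])
      show "is_join X A' (B' \<union> A)" using that(1) join' by auto
    qed
    have IH_A: "8 * a \<le> 3 * card A \<and>
        (a > 0 \<and> 3 * card A = 8 * a \<longrightarrow> even (poly (h_polynomial a (clique_complex A)) (- 1)))"
      by (rule less.hyps[OF card_less(1) ab(1)]) (rule A_factor)
    have IH_B: "8 * b \<le> 3 * card B \<and>
        (b > 0 \<and> 3 * card B = 8 * b \<longrightarrow> even (poly (h_polynomial b (clique_complex B)) (- 1)))"
      by (rule less.hyps[OF card_less(2) ab(2)]) (rule B_factor)
    have "card X = card A + card B"
      using A fin card_mono[OF fin, of A] finite_subset[OF _ fin, of A]
      by (simp add: B_def card_Diff_subset psubset_imp_subset)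
    moreover have "h_polynomial d (clique_complex X) =
        h_polynomial a (clique_complex A) * h_polynomial b (clique_complex B)"
      using h_polynomial_join[OF ab(1,2) _ join] less.prems(1) ab(3) by simp
    \<comment> \<open>Equality for \<open>X\<close> forces equality for \<open>A\<close>; since
      \<open>a\<close> is positive, one factor of the product of values at -1 is then even.\<close>
    ultimately show ?thesis using IH_A IH_B \<open>a > 0\<close> ab(3) by auto
  qed
qed

text \<open>The polynomial stays fixed while \<open>X\<close> varies, since removing a two-point
  factor yields the same \<gamma>-polynomial for a smaller \<open>d\<close>.\<close>

lemma not_gamma_polynomial:
  fixes k :: nat and r :: "int poly"
  defines "p \<equiv> [:1, 1:] ^ k + [:0, 1:] * r"
  assumes k: "k \<ge> 3" "degree r \<le> k - 2" and r0: "coeff r 0 = 1"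
    and not_dvd: "\<not> [:1, 1:] dvd r"
    and "npm d X" "is_gamma_polynomial d (clique_complex X) p"
  shows False
  using assms(6,7)
proof (induction d arbitrary: X rule: less_induct)
  case (less d)
  let ?h = "\<lambda>d X. h_polynomial d (clique_complex X)"
  \<comment> \<open>As t r(t) has degree below k, the coefficient is that of (1 + t)^k. It bounds
    \<open>d\<close> from below by 2k and is the source of the odd value at the end.\<close>
  have "coeff p k = 1"
  proof -
    have "coeff r (k - 1) = 0" using k by (intro coeff_eq_0) linarith
    then have "coeff ([:0, 1:] * r) k = 0" using k by (cases k) auto
    then show ?thesis by (simp add: p_def coeff_linear_power)
  qed
  then have "k \<le> degree p" by (intro le_degree) simp
  also have "degree p \<le> d div 2" using less.prems(2) by (simp add: is_gamma_polynomial_def)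
  finally have d: "2 * k \<le> d" by simp
  have p0: "coeff p 0 = 1" by (simp add: p_def coeff_linear_poly_power)
  have p1: "coeff p 1 = int k + 1" using k r0 by (simp add: p_def coeff_linear_poly_power)
  have "poly r (- 1) \<noteq> 0" using not_dvd poly_eq_0_iff_dvd[of r "- 1"] by simp
  then have p_neg: "poly p (- 1) \<noteq> 0" using k by (simp add: p_def power_0_left)
  have h_join: "?h d X = ?h a A * ?h (d - a) B \<and> npm (d - a) B \<and> a \<le> d"
    if "is_join X A B" "npm a A" for a A B
    using npm_join_factor[OF less.prems(1) that] h_polynomial_join[OF that(2) _ _ that(1), of "d - a"]
      less.prems(1) by auto
  show False
  proof (cases "\<exists>a A B. is_join X A B \<and> npm a A \<and> (a = 1 \<or> a = 2 \<and> card A = 5)")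
    case True
    then obtain a A B where A: "is_join X A B" "npm a A" "a = 1 \<or> a = 2 \<and> card A = 5" by blast
    note h = h_join[OF A(1,2)]
    from A(3) show False
    proof
      assume "a = 1"
      then obtain e where e: "d = Suc e" using h by (cases d) auto
      then have B: "npm e B" using h \<open>a = 1\<close> by simp
      have "?h (Suc e) X = [:1, 1:] * ?h e B"
        using h h_polynomial_two_points A(2) \<open>a = 1\<close> unfolding e by (simp only: diff_Suc_1)
      then have "is_gamma_polynomial e (clique_complex B) p"
        by (rule is_gamma_polynomial_suspension[OF less.prems(2)[unfolded e]])
      then show False using less.IH[OF _ B] e by blast
    next
      assume "a = 2 \<and> card A = 5"
      then have "?h d X = [:1, 3, 1:] * ?h (d - 2) B"
        using h h_polynomial_pentagon A(2) by simp
      then have "[:1, 3, 1:] dvd ?h d X" by (rule dvdI)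
      then show False using gamma_minus_one_if_pentagon_dvd less.prems(2) p_neg by blast
    qed
  next
    case False
    have large: "8 * d \<le> 3 * card X \<and>
        (d > 0 \<and> 3 * card X = 8 * d \<longrightarrow> even (poly (?h d X) (- 1)))"
      by (rule npm_factor_or_large[OF less.prems(1)]) (use False in blast)
    have "int (card X) - int d = int d + (int k + 1)"
      using gamma_coeff_1[OF less.prems(2)] d k npm_finite[OF less.prems(1)]
      by (simp add: p0 p1[simplified] face_number_0 face_number_1)
    then have "card X = 2 * d + k + 1" by linarith
    \<comment> \<open>From 8d \<le> 3(2d + k + 1) follows 2d \<le> 3k + 3, and 2k \<le> d turns this
      into k \<le> 3. All inequalities are then equalities.\<close>
    with large d k have "k = 3" "d = 2 * 3" "3 * card X = 8 * d" by linarith+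
    then have "even (poly (?h (2 * 3) X) (- 1))" using large by simp
    moreover have "poly (?h (2 * 3) X) (- 1) = coeff p 3 * (- 1) ^ 3"
      by (rule poly_h_polynomial_minus_one) (use less.prems(2) \<open>d = 2 * 3\<close> in simp)
    ultimately show False using \<open>coeff p k = 1\<close> \<open>k = 3\<close> by simp
  qed
qed

end

section \<open>Homology spheres are normal pseudomanifolds\<close>

lemma chain_support:
  "c \<in> simplicial_chains \<Delta> i \<Longrightarrow> c f \<noteq> 0 \<Longrightarrow> f \<in> \<Delta> \<and> int (card f) = i + 1"
  by (simp add: simplicial_chains_def)

lemma boundary_0_chain:
  assumes "c \<in> simplicial_chains \<Delta> 0"
  shows "boundary \<Delta> c g = (if g = {} then \<Sum>x\<in>\<Union>\<Delta>. c {x} else 0)"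
proof (cases "g = {}")
  case False
  have "c (insert v g) = 0" if "v \<notin> g" for v
  proof (rule ccontr)
    assume "c (insert v g) \<noteq> 0"
    then have "card (insert v g) = 1" using chain_support[OF assms] by fastforce
    then show False using that False by (metis card_1_singletonE insert_iff singletonD all_not_in_conv)
  qed
  then show ?thesis using False by (simp add: boundary_def)
qed (simp add: boundary_def)

lemma cycles_0:
  "cycles \<Delta> 0 = {c \<in> simplicial_chains \<Delta> 0. (\<Sum>x\<in>\<Union>\<Delta>. c {x}) = 0}"
  by (auto simp: cycles_def fun_eq_iff boundary_0_chain split: if_splits)

text \<open>The 0-chain [u] - [v], provided that u and v differ; for u = v the formula gives
  [u].\<close>

definition point_difference :: "'v \<Rightarrow> 'v \<Rightarrow> 'v set \<Rightarrow> 'k::field" where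
  "point_difference u v f = (if f = {u} then 1 else if f = {v} then - 1 else 0)"

lemma simplicial_complex_closed:
  "simplicial_complex \<Delta> \<Longrightarrow> f \<in> \<Delta> \<Longrightarrow> g \<subseteq> f \<Longrightarrow> g \<in> \<Delta>"
  by (simp add: simplicial_complex_def)

lemma simplicial_complex_vertex: "simplicial_complex \<Delta> \<Longrightarrow> v \<in> \<Union>\<Delta> \<Longrightarrow> {v} \<in> \<Delta>"
  unfolding simplicial_complex_def by blast

lemma point_difference_cycle:
  assumes "simplicial_complex \<Delta>" "u \<in> \<Union>\<Delta>" "v \<in> \<Union>\<Delta>" "u \<noteq> v"
  shows "(point_difference u v :: _ \<Rightarrow> 'k::field) \<in> cycles \<Delta> 0"
proof -
  have fin: "finite (\<Union>\<Delta>)" using assms(1) by (simp add: simplicial_complex_def)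
  have "(\<Sum>x\<in>\<Union>\<Delta>. point_difference u v {x} :: 'k) =
      (\<Sum>x\<in>\<Union>\<Delta>. (if x = u then 1 else 0) - (if x = v then 1 else 0))"
    using assms(4) by (intro sum.cong) (auto simp: point_difference_def)
  also have "\<dots> = 0" using fin assms by (simp add: sum_subtractf)
  finally have "(\<Sum>x\<in>\<Union>\<Delta>. point_difference u v {x} :: 'k) = 0" .
  moreover have "{u} \<in> \<Delta>" "{v} \<in> \<Delta>"
    using simplicial_complex_vertex[OF assms(1)] assms(2,3) by blast+
  then have "(point_difference u v :: _ \<Rightarrow> 'k) \<in> simplicial_chains \<Delta> 0"
    by (auto simp: simplicial_chains_def point_difference_def)
  ultimately show ?thesis by (simp add: cycles_0)
qed

lemma zero_in_simplicial_chains: "0 \<in> simplicial_chains \<Delta> i"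
  by (simp add: simplicial_chains_def)

lemma boundary_0: "boundary \<Delta> 0 = 0"
  by (simp add: boundary_def fun_eq_iff)

lemma zero_in_cycles: "0 \<in> cycles \<Delta> i"
  by (simp add: cycles_def zero_in_simplicial_chains boundary_0)

lemma zero_in_boundaries: "0 \<in> boundaries \<Delta> i"
  using imageI[OF zero_in_simplicial_chains, of "boundary \<Delta>" \<Delta> "i + 1"]
  by (simp add: boundaries_def boundary_0)

text \<open>The classes of c and 0 coincide, and c lies in its own class, so 0 and c are homologous
  in this order. This accounts for the sign.\<close>

lemma cycle_in_boundaries:
  fixes c :: "'v::linorder set \<Rightarrow> 'k::field"
  assumes "reduced_homology_zero TYPE('k) \<Delta> i" "c \<in> cycles \<Delta> i"
  shows "- c \<in> boundaries \<Delta> i"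
proof -
  have "homologous \<Delta> i `` {c} = homologous \<Delta> i `` {0}"
    using quotientI[OF assms(2), of "homologous \<Delta> i"] assms(1)
    unfolding reduced_homology_zero_def reduced_homology_def by simp
  moreover have "c \<in> homologous \<Delta> i `` {c}"
    using assms(2) zero_in_boundaries by (simp add: homologous_def)
  ultimately have "(0, c) \<in> homologous \<Delta> i" by blast
  then show ?thesis by (simp add: homologous_def)
qed

text \<open>No edge leaves \<open>S\<close>, and an edge inside \<open>S\<close> contributes
  opposite values at its two ends.\<close>

lemma boundary_1_chain_sum:
  fixes b :: "'v::linorder set \<Rightarrow> 'k::field"
  assumes "finite (\<Union>\<Delta>)" "S \<subseteq> \<Union>\<Delta>" "b \<in> simplicial_chains \<Delta> 1"
    and "\<And>x y. x \<in> S \<Longrightarrow> y \<in> \<Union>\<Delta> - S \<Longrightarrow> {x, y} \<notin> \<Delta>"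
  shows "(\<Sum>x\<in>S. boundary \<Delta> b {x}) = 0"
proof -
  \<comment> \<open>The boundary of an edge is its upper end minus its lower end. Thus
    \<open>G x y\<close> is the contribution to \<open>x\<close> as upper end, and
    \<open>G y x\<close> is subtracted at \<open>x\<close> as lower end; over all pairs from
    \<open>S\<close> the two cancel.\<close>
  define G where "G x y = (if y < x then b {x, y} else 0)" for x y
  have "boundary \<Delta> b {x} = (\<Sum>y\<in>S. G x y - G y x)" if x: "x \<in> S" for x
  proof -
    have below: "{w \<in> {x}. w < y} = (if x < y then {x} else {})" for y by auto
    have "boundary \<Delta> b {x} = (\<Sum>y\<in>\<Union>\<Delta> - {x}. G x y - G y x)"
      unfolding boundary_def G_def below
      by (intro sum.cong) (auto simp: insert_commute)
    also have "\<dots> = (\<Sum>y\<in>S - {x}. G x y - G y x)"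
    proof (rule sum.mono_neutral_right)
      show "\<forall>y\<in>\<Union>\<Delta> - {x} - (S - {x}). G x y - G y x = 0"
      proof
        fix y assume y: "y \<in> \<Union>\<Delta> - {x} - (S - {x})"
        then have "{x, y} \<notin> \<Delta>" using assms(4)[OF x] by blast
        then have "b {x, y} = 0" using chain_support[OF assms(3)] by blast
        then show "G x y - G y x = 0" by (simp add: G_def insert_commute)
      qed
    qed (use assms in auto)
    also have "\<dots> = (\<Sum>y\<in>S. G x y - G y x)"
      using assms finite_subset by (intro sum.mono_neutral_left) auto
    finally show ?thesis .
  qed
  then have "(\<Sum>x\<in>S. boundary \<Delta> b {x}) = (\<Sum>x\<in>S. \<Sum>y\<in>S. G x y) - (\<Sum>x\<in>S. \<Sum>y\<in>S. G y x)"
    by (simp add: sum_subtractf)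
  also have "(\<Sum>x\<in>S. \<Sum>y\<in>S. G y x) = (\<Sum>x\<in>S. \<Sum>y\<in>S. G x y)" by (rule sum.swap)
  finally show ?thesis by simp
qed

text \<open>If no edge left \<open>S\<close>, the coefficient sum over \<open>S\<close> would vanish
  on all boundaries, but it does not vanish on [u] - [v] with u inside and v outside.\<close>

lemma conn_if_homology_zero:
  fixes \<Delta> :: "'v::linorder set set"
  assumes "simplicial_complex \<Delta>" "reduced_homology_zero TYPE('k::field) \<Delta> 0"
  shows "conn (\<lambda>x y. {x, y} \<in> \<Delta>) (\<Union>\<Delta>)"
  unfolding conn_def
proof (intro allI impI)
  fix S assume S: "S \<noteq> {} \<and> S \<subset> \<Union>\<Delta>"
  then obtain u v where uv: "u \<in> S" "v \<in> \<Union>\<Delta> - S" by blast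
  let ?c = "point_difference u v :: 'v set \<Rightarrow> 'k"
  have fin: "finite (\<Union>\<Delta>)" using assms(1) by (simp add: simplicial_complex_def)
  have "?c \<in> cycles \<Delta> 0" using point_difference_cycle[OF assms(1)] uv S by blast
  then have "- ?c \<in> boundaries \<Delta> 0" using cycle_in_boundaries assms(2) by blast
  then obtain b :: "'v set \<Rightarrow> 'k" where b: "b \<in> simplicial_chains \<Delta> 1" "boundary \<Delta> b = - ?c"
    by (auto simp: boundaries_def)
  show "\<exists>x\<in>S. \<exists>y\<in>\<Union>\<Delta> - S. {x, y} \<in> \<Delta>"
  proof (rule ccontr)
    assume "\<not> ?thesis"
    then have "(\<Sum>x\<in>S. boundary \<Delta> b {x}) = 0"
      using boundary_1_chain_sum[OF fin _ b(1), of S] S by blast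
    moreover have "(\<Sum>x\<in>S. boundary \<Delta> b {x}) = (\<Sum>x\<in>S. if x = u then - 1 else 0)"
      unfolding b(2) using uv by (intro sum.cong) (auto simp: point_difference_def)
    moreover have "finite S" using S fin finite_subset by blast
    ultimately show False using uv by simp
  qed
qed

text \<open>Without edges the homology is the space of 0-chains with coefficient sum 0. It is
  trivial for at most one vertex, and three vertices give two independent differences.\<close>

lemma two_points_if_homology_field:
  fixes \<Delta> :: "'v::linorder set set"
  assumes "simplicial_complex \<Delta>" "reduced_homology_field TYPE('k::field) \<Delta> 0"
    and card_le: "\<And>f. f \<in> \<Delta> \<Longrightarrow> card f \<le> 1"
  shows "card (\<Union>\<Delta>) = 2"
proof -
  have fin: "finite (\<Union>\<Delta>)" using assms(1) by (simp add: simplicial_complex_def)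
  let ?Z = "cycles \<Delta> 0 :: ('v set \<Rightarrow> 'k) set"
  have "c = 0" if "c \<in> simplicial_chains \<Delta> 1" for c :: "'v set \<Rightarrow> 'k"
  proof
    fix f
    show "c f = 0 f" using chain_support[OF that, of f] card_le[of f] by fastforce
  qed
  then have no_1_chains: "(simplicial_chains \<Delta> 1 :: ('v set \<Rightarrow> 'k) set) = {0}"
    using zero_in_simplicial_chains by blast
  have "(boundaries \<Delta> 0 :: ('v set \<Rightarrow> 'k) set) = {0}"
    by (simp add: boundaries_def no_1_chains boundary_0)
  \<comment> \<open>Classes are singletons, so the isomorphism becomes an injective linear map
    \<open>\<psi>\<close> on the cycles themselves.\<close>
  then have cls: "homology_class \<Delta> 0 c = {c}" if "c \<in> ?Z" for c :: "'v set \<Rightarrow> 'k"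
    using that by (auto simp: homologous_def)
  obtain \<phi> :: "('v set \<Rightarrow> 'k) set \<Rightarrow> 'k" where
    \<phi>: "bij_betw \<phi> (reduced_homology \<Delta> 0) UNIV"
    and add: "\<And>a b. a \<in> ?Z \<Longrightarrow> b \<in> ?Z \<Longrightarrow>
      \<phi> (homology_class \<Delta> 0 (a + b)) = \<phi> (homology_class \<Delta> 0 a) + \<phi> (homology_class \<Delta> 0 b)"
    and scale: "\<And>x a. a \<in> ?Z \<Longrightarrow>
      \<phi> (homology_class \<Delta> 0 (\<lambda>f. x * a f)) = x * \<phi> (homology_class \<Delta> 0 a)"
    using assms(2) unfolding reduced_homology_field_def by blast
  define \<psi> where "\<psi> c = \<phi> {c}" for c
  have quot: "reduced_homology \<Delta> 0 = (\<lambda>c. {c}) ` ?Z"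
    using cls by (auto simp: reduced_homology_def quotient_def)
  have inj: "a = b" if "a \<in> ?Z" "b \<in> ?Z" "\<psi> a = \<psi> b" for a b
    using that \<phi> unfolding quot bij_betw_def inj_on_def \<psi>_def by blast
  have Z_scale: "(\<lambda>f. x * a f) \<in> ?Z" if "a \<in> ?Z" for x a
    using that by (auto simp: cycles_0 simplicial_chains_def sum_distrib_left[symmetric])
  have Z_add: "a + b \<in> ?Z" if "a \<in> ?Z" "b \<in> ?Z" for a b
  proof -
    have "a f \<noteq> 0 \<or> b f \<noteq> 0" if "(a + b) f \<noteq> 0" for f using that by auto
    then have "a + b \<in> simplicial_chains \<Delta> 0"
      using that unfolding cycles_0 simplicial_chains_def by blast
    then show ?thesis using that by (simp add: cycles_0 sum.distrib)
  qed
  have \<psi>_add: "\<psi> (a + b) = \<psi> a + \<psi> b" if "a \<in> ?Z" "b \<in> ?Z" for a b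
    using add[OF that] by (simp add: cls that Z_add \<psi>_def)
  have \<psi>_scale: "\<psi> (\<lambda>f. x * a f) = x * \<psi> a" if "a \<in> ?Z" for x a
    using scale[OF that] by (simp add: cls that Z_scale \<psi>_def)
  have \<psi>_0: "\<psi> 0 = 0"
    using \<psi>_scale[OF zero_in_cycles, of 0] by (simp add: zero_fun_def)
  have "\<not> card (\<Union>\<Delta>) \<le> 1"
  proof
    assume "card (\<Union>\<Delta>) \<le> 1"
    then have unique: "\<forall>x\<in>\<Union>\<Delta>. \<forall>y\<in>\<Union>\<Delta>. x = y"
      using card_le_Suc0_iff_eq[OF fin] by (simp only: One_nat_def)
    have "c = 0" if c: "c \<in> ?Z" for c
    proof
      fix f show "c f = 0 f"
      proof (rule ccontr)
        assume "c f \<noteq> 0 f"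
        then have f: "f \<in> \<Delta>" "card f = 1"
          using c chain_support[of c \<Delta> 0 f] by (auto simp: cycles_0)
        then obtain x where "f = {x}" by (auto simp: card_1_singleton_iff)
        then have "x \<in> \<Union>\<Delta>" using f by blast
        then have "\<Union>\<Delta> = {x}" using unique by blast
        then show False using c \<open>f = {x}\<close> \<open>c f \<noteq> 0 f\<close> by (simp add: cycles_0)
      qed
    qed
    then have "?Z \<subseteq> {0}" by blast
    then have trivial: "(UNIV :: 'k set) \<subseteq> {\<phi> {0}}"
      using \<phi> by (auto simp: quot bij_betw_def)
    have "(0 :: 'k) = 1"
      using subsetD[OF trivial UNIV_I, of 0] subsetD[OF trivial UNIV_I, of 1] by simp
    then show False by simp
  qed
  moreover have "\<not> card (\<Union>\<Delta>) \<ge> 3"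
  proof
    assume "card (\<Union>\<Delta>) \<ge> 3"
    then obtain T where T: "T \<subseteq> \<Union>\<Delta>" "card T = 3" using obtain_subset_with_card_n by metis
    then obtain u v w where uvw: "T = {u, v, w}" "u \<noteq> v" "v \<noteq> w" "u \<noteq> w"
      unfolding card_3_iff by blast
    then have vertices: "u \<in> \<Union>\<Delta>" "v \<in> \<Union>\<Delta>" "w \<in> \<Union>\<Delta>"
      using T(1) by (simp_all only: insert_subset)
    let ?a = "point_difference u v :: 'v set \<Rightarrow> 'k"
    let ?b = "point_difference u w :: 'v set \<Rightarrow> 'k"
    \<comment> \<open>This combination is killed by \<open>\<psi>\<close>, hence zero. Its
      coefficient at \<open>{w}\<close> is \<open>\<psi> ?a\<close>, so \<open>?a\<close> would be
      zero as well.\<close>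
    let ?c = "(\<lambda>f. \<psi> ?b * ?a f) + (\<lambda>f. - \<psi> ?a * ?b f)"
    have Z: "?a \<in> ?Z" "?b \<in> ?Z" using point_difference_cycle[OF assms(1)] uvw vertices by blast+
    note Z' = Z_scale[OF Z(1), of "\<psi> ?b"] Z_scale[OF Z(2), of "- \<psi> ?a"]
    have "\<psi> ?c = \<psi> 0"
      unfolding \<psi>_add[OF Z'] \<psi>_scale[OF Z(1)] \<psi>_scale[OF Z(2)] by (simp add: \<psi>_0)
    then have "?c = 0" by (rule inj[OF Z_add[OF Z'] zero_in_cycles])
    from fun_cong[OF this, of "{w}"] have "\<psi> ?a = \<psi> 0"
      using uvw \<psi>_0 by (simp add: point_difference_def)
    then have "?a = 0" by (rule inj[OF Z(1) zero_in_cycles])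
    from fun_cong[OF this, of "{u}"] show False by (simp add: point_difference_def)
  qed
  ultimately show ?thesis by linarith
qed

section \<open>Links and flagness in terms of the edge graph\<close>

lemma simplicial_complex_link:
  assumes "simplicial_complex \<Delta>" "f \<in> \<Delta>"
  shows "simplicial_complex (link \<Delta> f)"
  unfolding simplicial_complex_def
proof (intro conjI ballI allI impI)
  note closed = simplicial_complex_closed[OF assms(1)]
  have "\<Union>(link \<Delta> f) \<subseteq> \<Union>\<Delta>" by (auto simp: link_def)
  then show "finite (\<Union>(link \<Delta> f))"
    using assms(1) finite_subset unfolding simplicial_complex_def by blast
  show "{} \<in> link \<Delta> f" using assms closed[of f "{}"] by (simp add: link_def)
  fix h g assume h: "h \<in> link \<Delta> f" and g: "g \<subseteq> h"
  have "g \<union> f \<in> \<Delta>" by (rule closed[of "h \<union> f"]) (use h g in \<open>auto simp: link_def\<close>)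
  moreover have "g \<in> \<Delta>" by (rule closed[of h]) (use h g in \<open>auto simp: link_def\<close>)
  ultimately show "g \<in> link \<Delta> f" using h g by (auto simp: link_def)
qed

lemma maximal_face_exists:
  assumes "simplicial_complex \<Delta>" "f \<in> \<Delta>"
  obtains g where "maximal_face \<Delta> g" "f \<subseteq> g"
proof -
  have "finite (\<Union>\<Delta>)" using assms(1) by (simp add: simplicial_complex_def)
  then obtain g where "g \<in> \<Delta> \<and> f \<subseteq> g" "\<And>h. h \<in> \<Delta> \<and> f \<subseteq> h \<Longrightarrow> card h \<le> card g"
    using assms(2) by (rule_tac greatest_card_subset[of "\<Union>\<Delta>" "\<lambda>h. h \<in> \<Delta> \<and> f \<subseteq> h" f]) auto
  moreover from this have "maximal_face \<Delta> g"
    using \<open>finite (\<Union>\<Delta>)\<close> finite_subset[of _ "\<Union>\<Delta>"] card_seteq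
    unfolding maximal_face_def by (metis Union_upper subset_trans)
  ultimately show ?thesis using that by blast
qed

definition edge :: "'v set set \<Rightarrow> 'v \<Rightarrow> 'v \<Rightarrow> bool" where
  "edge \<Delta> x y \<longleftrightarrow> x \<noteq> y \<and> {x, y} \<in> \<Delta>"

interpretation edge: adjacency "edge \<Delta>" for \<Delta> :: "'v set set"
  by unfold_locales (auto simp: edge_def insert_commute)

text \<open>A clique that is not a face while all its proper subsets are is a minimal non-face,
  hence a pair; but pairs in a clique are edges.\<close>

lemma flag_clique_complex:
  assumes "flag_complex \<Delta>"
  shows "edge.clique_complex \<Delta> (\<Union>\<Delta>) = \<Delta>"
proof
  have sc: "simplicial_complex \<Delta>" using assms by (simp add: flag_complex_def)
  show "\<Delta> \<subseteq> edge.clique_complex \<Delta> (\<Union>\<Delta>)"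
  proof
    fix f assume f: "f \<in> \<Delta>"
    then have "{x, y} \<in> \<Delta>" if "x \<in> f" "y \<in> f" for x y
      using simplicial_complex_closed[OF sc f, of "{x, y}"] that by simp
    then show "f \<in> edge.clique_complex \<Delta> (\<Union>\<Delta>)"
      using f by (auto simp: edge.clique_complex_def edge.clique_def edge_def)
  qed
  show "edge.clique_complex \<Delta> (\<Union>\<Delta>) \<subseteq> \<Delta>"
  proof
    fix f assume "f \<in> edge.clique_complex \<Delta> (\<Union>\<Delta>)"
    then have f: "f \<subseteq> \<Union>\<Delta>" "edge.clique \<Delta> f" by (auto simp: edge.clique_complex_def)
    have "finite f" using f sc finite_subset by (auto simp: simplicial_complex_def)
    then show "f \<in> \<Delta>" using f
    proof (induction f rule: finite_psubset_induct)
      case (psubset f)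
      show ?case
      proof (rule ccontr)
        assume "f \<notin> \<Delta>"
        moreover have "g \<in> \<Delta>" if "g \<subset> f" for g
          using psubset.IH[OF that] psubset.prems that edge.clique_subset by blast
        ultimately have "minimal_nonface \<Delta> f"
          using psubset.prems by (simp add: minimal_nonface_def)
        then have "card f = 2" using assms by (simp add: flag_complex_def)
        then obtain x y where xy: "f = {x, y}" "x \<noteq> y" by (auto simp: card_2_iff)
        then have "edge \<Delta> x y" using psubset.prems(2) by (simp add: edge.clique_def)
        then show False using \<open>f \<notin> \<Delta>\<close> xy by (simp add: edge_def)
      qed
    qed
  qed
qed

text \<open>Links are treated by induction on the codimension of the face. In codimension 1 the
  homology of the link in degree 0 is the field, which gives two points; in higher codimension it
  vanishes, which gives connectedness.\<close>

lemma homology_sphere_npm: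
  fixes \<Delta> :: "'v::linorder set set"
  assumes sphere: "homology_sphere TYPE('k::field) d \<Delta>" and flag: "flag_complex \<Delta>"
  shows "edge.npm \<Delta> d (\<Union>\<Delta>)"
proof -
  have sc: "simplicial_complex \<Delta>" using flag by (simp add: flag_complex_def)
  have fin: "finite (\<Union>\<Delta>)" using sc by (simp add: simplicial_complex_def)
  have clique: "f \<in> \<Delta> \<longleftrightarrow> f \<subseteq> \<Union>\<Delta> \<and> edge.clique \<Delta> f" for f
    using flag_clique_complex[OF flag] by (auto simp: edge.clique_complex_def)
  have finite_face: "finite f" if "f \<in> \<Delta>" for f
    using that fin finite_subset[of f "\<Union>\<Delta>"] by blast
  have card_maximal: "card f = d" if "maximal_face \<Delta> f" for f
    using that sphere by (simp add: homology_sphere_def pure_complex_def)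
  have card_le: "card f \<le> d" if f: "f \<in> \<Delta>" for f
  proof -
    obtain g where g: "maximal_face \<Delta> g" "f \<subseteq> g" by (rule maximal_face_exists[OF sc f])
    then have "finite g" using finite_face by (simp add: maximal_face_def)
    then show ?thesis using card_mono[OF _ g(2)] card_maximal[OF g(1)] by simp
  qed
  have extend: "insert x f \<in> \<Delta> \<and> x \<notin> f"
    if f: "f \<in> \<Delta>" and x: "x \<in> edge.nbrs \<Delta> f (\<Union>\<Delta>)" for f x
  proof -
    have x: "x \<in> \<Union>\<Delta>" "\<forall>y\<in>f. edge \<Delta> x y" using x by (auto simp: edge.nbrs_def)
    note f = iffD1[OF clique f]
    have "insert x f \<subseteq> \<Union>\<Delta>" using f x by blast
    moreover have "edge.clique \<Delta> (insert x f)" using f x by (simp add: edge.clique_insert)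
    ultimately have "insert x f \<in> \<Delta>" by (intro iffD2[OF clique] conjI)
    then show ?thesis using x edge.E_irrefl[of \<Delta> x] by blast
  qed
  have nbr_if_extends: "x \<in> edge.nbrs \<Delta> f (\<Union>\<Delta>)" if xf: "insert x f \<in> \<Delta>" "x \<notin> f" for f x
  proof -
    have "insert x f \<subseteq> \<Union>\<Delta>" "edge.clique \<Delta> (insert x f)" using iffD1[OF clique xf(1)] by blast+
    then have "x \<in> \<Union>\<Delta>" "\<forall>y\<in>f. edge \<Delta> x y"
      using xf(2) by (blast, auto simp: edge.clique_insert)
    then show ?thesis by (auto simp: edge.nbrs_def)
  qed
  have link_vertices: "\<Union>(link \<Delta> f) = edge.nbrs \<Delta> f (\<Union>\<Delta>)" if "f \<in> \<Delta>" for f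
  proof
    show "\<Union>(link \<Delta> f) \<subseteq> edge.nbrs \<Delta> f (\<Union>\<Delta>)"
    proof
      fix x assume "x \<in> \<Union>(link \<Delta> f)"
      then obtain g where g: "x \<in> g" "g \<inter> f = {}" "g \<union> f \<in> \<Delta>" by (auto simp: link_def)
      then have "insert x f \<in> \<Delta>"
        using simplicial_complex_closed[OF sc, of "g \<union> f" "insert x f"] by simp
      then show "x \<in> edge.nbrs \<Delta> f (\<Union>\<Delta>)" using nbr_if_extends g by blast
    qed
    show "edge.nbrs \<Delta> f (\<Union>\<Delta>) \<subseteq> \<Union>(link \<Delta> f)"
    proof
      fix x assume x: "x \<in> edge.nbrs \<Delta> f (\<Union>\<Delta>)"
      then have "{x} \<in> \<Delta>" using sc by (auto simp: edge.nbrs_def intro: simplicial_complex_vertex)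
      then have "{x} \<in> link \<Delta> f" using extend[OF that x] by (simp add: link_def)
      then show "x \<in> \<Union>(link \<Delta> f)" by blast
    qed
  qed
  have card_link: "card g \<le> d - card f" if "f \<in> \<Delta>" "g \<in> link \<Delta> f" for f g
  proof -
    have "card (g \<union> f) = card g + card f"
      using that finite_face by (intro card_Un_disjoint) (auto simp: link_def)
    moreover have "card (g \<union> f) \<le> d" using card_le that by (simp add: link_def)
    ultimately show ?thesis by simp
  qed
  have "edge.npm \<Delta> n (edge.nbrs \<Delta> f (\<Union>\<Delta>))" if "f \<in> \<Delta>" "d = card f + n" for f n
    using that
  proof (induction n arbitrary: f rule: nat_less_induct)
    case (1 n)
    let ?N = "edge.nbrs \<Delta> f (\<Union>\<Delta>)"
    have link_sc: "simplicial_complex (link \<Delta> f)"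
      using simplicial_complex_link sc 1 by blast
    consider "n = 0" | "n = 1" | m where "n = Suc (Suc m)" by (metis One_nat_def not0_implies_Suc)
    then show ?case
    proof cases
      case 1
      have "False" if "x \<in> ?N" for x
        using extend[OF \<open>f \<in> \<Delta>\<close> that] card_le[of "insert x f"] finite_face \<open>f \<in> \<Delta>\<close>
          \<open>d = card f + n\<close> 1 by simp
      then show ?thesis using 1 by auto
    next
      case 2
      then have "int d - 1 - int (card f) = 0" using \<open>d = card f + n\<close> by simp
      then have "reduced_homology_field TYPE('k) (link \<Delta> f) 0"
        using sphere \<open>f \<in> \<Delta>\<close> unfolding homology_sphere_def by metis
      then have "card ?N = 2"
        using two_points_if_homology_field[OF link_sc] card_link[OF \<open>f \<in> \<Delta>\<close>]
          \<open>d = card f + n\<close> 2 link_vertices[OF \<open>f \<in> \<Delta>\<close>] by simp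
      \<comment> \<open>An edge in the link of a ridge would produce a face with d + 1
        elements.\<close>
      moreover have "\<not> edge \<Delta> x y" if "x \<in> ?N" "y \<in> ?N" for x y
      proof
        assume "edge \<Delta> x y"
        have y: "insert y f \<in> \<Delta>" "y \<notin> f" using extend[OF \<open>f \<in> \<Delta>\<close> that(2)] by auto
        have "x \<in> edge.nbrs \<Delta> (insert y f) (\<Union>\<Delta>)"
          using that(1) \<open>edge \<Delta> x y\<close> by (simp add: edge.nbrs_def)
        then have "insert x (insert y f) \<in> \<Delta>" "x \<notin> insert y f" using extend[OF y(1)] by auto
        then show False using y
          using card_le[of "insert x (insert y f)"] finite_face[OF \<open>f \<in> \<Delta>\<close>]
            \<open>d = card f + n\<close> 2 by simp
      qed
      ultimately show ?thesis using 2 by simp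
    next
      case 3
      then have "0 < int d - 1 - int (card f)" using \<open>d = card f + n\<close> by simp
      then have "reduced_homology_zero TYPE('k) (link \<Delta> f) 0"
        using sphere \<open>f \<in> \<Delta>\<close> unfolding homology_sphere_def by blast
      then have conn: "conn (\<lambda>x y. {x, y} \<in> link \<Delta> f) ?N"
        using conn_if_homology_zero[OF link_sc] link_vertices[OF \<open>f \<in> \<Delta>\<close>] by simp
      have "conn (edge \<Delta>) ?N"
        unfolding conn_def
      proof (intro allI impI)
        fix S assume "S \<noteq> {} \<and> S \<subset> ?N"
        then obtain x y where xy: "x \<in> S" "y \<in> ?N - S" "{x, y} \<in> link \<Delta> f"
          using conn unfolding conn_def by meson
        then have "edge \<Delta> x y" by (auto simp: link_def edge_def)
        then show "\<exists>x\<in>S. \<exists>y\<in>?N - S. edge \<Delta> x y" using xy by blast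
      qed
      \<comment> \<open>Connectedness allows the empty set, so purity has to exclude it: a face
        without common neighbours is maximal and has d elements.\<close>
      moreover have "?N \<noteq> {}"
      proof
        assume empty: "?N = {}"
        have "maximal_face \<Delta> f"
          unfolding maximal_face_def
        proof (intro conjI ballI impI)
          fix g assume g: "g \<in> \<Delta>" "f \<subseteq> g"
          show "g = f"
          proof (rule ccontr)
            assume "g \<noteq> f"
            then obtain x where "x \<in> g - f" using g by blast
            moreover from this have "insert x f \<in> \<Delta>"
              using simplicial_complex_closed[OF sc g(1), of "insert x f"] g(2) by blast
            ultimately show False using nbr_if_extends empty by blast
          qed
        qed fact
        then have "card f = d" by (rule card_maximal)
        then show False using 3 \<open>d = card f + n\<close> by linarith
      qed
      moreover have "finite ?N" by (rule finite_subset[OF _ fin]) (auto simp: edge.nbrs_def)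
      moreover have "edge.npm \<Delta> (Suc m) (edge.nbrs \<Delta> {x} ?N)" if "x \<in> ?N" for x
      proof -
        have x: "insert x f \<in> \<Delta>" "x \<notin> f" using extend[OF \<open>f \<in> \<Delta>\<close> that] by auto
        then have "d = card (insert x f) + Suc m"
          using \<open>d = card f + n\<close> 3 finite_face[OF \<open>f \<in> \<Delta>\<close>] by simp
        then have "edge.npm \<Delta> (Suc m) (edge.nbrs \<Delta> (insert x f) (\<Union>\<Delta>))"
          using "1.IH" 3 x by blast
        moreover have "edge.nbrs \<Delta> (insert x f) (\<Union>\<Delta>) = edge.nbrs \<Delta> {x} ?N"
          by (auto simp: edge.nbrs_def)
        ultimately show ?thesis by simp
      qed
      ultimately show ?thesis using 3 by simp
    qed
  qed
  moreover have "{} \<in> \<Delta>" using sc by (simp add: simplicial_complex_def)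
  ultimately have "edge.npm \<Delta> d (edge.nbrs \<Delta> {} (\<Union>\<Delta>))" by (metis add_0 card.empty)
  moreover have "edge.nbrs \<Delta> {} (\<Union>\<Delta>) = \<Union>\<Delta>" by (auto simp: edge.nbrs_def)
  ultimately show ?thesis by simp
qed

theorem theorem5p3:
  fixes k :: nat and r :: "int poly"
  assumes "k \<ge> 3"
    and "degree r \<le> k - 2"
    and "coeff r 0 = 1"
    and "\<not> [:1, 1:] dvd r"
  shows "\<not> (\<exists>(d :: nat) (\<Delta> :: 'v::linorder set set).
            homology_sphere TYPE('k::field) d \<Delta> \<and> flag_complex \<Delta> \<and>
            is_gamma_polynomial d \<Delta> ([:1, 1:] ^ k + [:0, 1:] * r))"
proof
  let ?p = "[:1, 1:] ^ k + [:0, 1:] * r"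
  assume "\<exists>(d :: nat) (\<Delta> :: 'v set set). homology_sphere TYPE('k) d \<Delta> \<and>
    flag_complex \<Delta> \<and> is_gamma_polynomial d \<Delta> ?p"
  then obtain d and \<Delta> :: "'v set set" where
    \<Delta>: "homology_sphere TYPE('k) d \<Delta>" "flag_complex \<Delta>" "is_gamma_polynomial d \<Delta> ?p"
    by blast
  have "is_gamma_polynomial d (edge.clique_complex \<Delta> (\<Union>\<Delta>)) ?p"
    using \<Delta>(3) by (simp only: flag_clique_complex[OF \<Delta>(2)])
  then show False
    by (rule edge.not_gamma_polynomial[OF assms homology_sphere_npm[OF \<Delta>(1,2)]])
qed

end
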